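(* Let $d\in\mathbb N$, $\kappa,\mathcal K\in(0,\infty)$, let $\mathcal L\in C^2(\mathbb R^d,\mathbb R)$ satisfy $(\nabla\mathcal L)(0)=0$ and $\kappa I_d\le(\operatorname{Hess}\mathcal L)(0)\le\mathcal K I_d$, let $\alpha,\beta\in(0,1)$, $\gamma,\varepsilon,\delta\in(0,\infty)$ satisfy $$\alpha=\Bigl(\frac{1-\gamma\varepsilon^{-1}\kappa}{1+\gamma\varepsilon^{-1}\kappa}\Bigr)^2\quad\text{and}\quad\gamma\le\frac{\varepsilon}{\sqrt{\kappa\mathcal K}},$$ and for every $\theta\in\mathbb R^d$ let $\Theta^\theta,\mathbf m^\theta,\mathbb M^\theta\colon\mathbb N_0\to\mathbb R^d$ satisfy for all $n\in\mathbb N$ that $$\Theta_0^\theta=\theta,\qquad \mathbf m_0^\theta=\mathbb M_0^\theta=0,$$ $$\mathbf m_n^\theta=\alpha\mathbf m_{n-1}^\theta+(1-\alpha)(\nabla\mathcal L)(\Theta_{n-1}^\theta),$$ $$\mathbb M_n^\theta=\beta\mathbb M_{n-1}^\theta+(1-\beta)\bigl[(\nabla\mathcal L)(\Theta_{n-1}^\theta)\bigr]^{\odot2},$$ $$\Theta_n^\theta=\Theta_{n-1}^\theta-\gamma(1-\alpha^n)^{-1}\bigl(\varepsilon\mathbf 1_d+(1-\beta^n)^{-1/2}(\mathbb M_n^\theta)^{\odot1/2}\bigr)^{\odot-1}\odot\mathbf m_n^\theta.$$ Then there exist $\eta,c>0$ such that for all $\theta\in\mathbb R^d$ with $\|\theta\|<\eta$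 and all $n\in\mathbb N$ one has $$\|\Theta_n^\theta\|\le c\,(\sqrt\alpha+\delta)^n.$$
   Context: $\mathbb N=\{1,2,\dots\}$, $\mathbb N_0=\mathbb N\cup\{0\}$; $\|\cdot\|$ is the Euclidean norm; $I_d$ is the identity matrix and $\mathbf 1_d=(1,\dots,1)\in\mathbb R^d$. For symmetric matrices $A\le B$ means $\langle v,Av\rangle\le\langle v,Bv\rangle$ for all $v$. For $x,y\in\mathbb R^d$, $x\odot y=(x_1y_1,\dots,x_dy_d)$ and $x^{\odot r}=(x_1^r,\dots,x_d^r)$ (componentwise power, whenever defined). *)

theory Defs
  imports "HOL-Analysis.Analysis"
begin

text \<open>
  The library's multiplicative structure on \<^typ>\<open>real ^ 'n\<close> is componentwise: \<open>x * y\<close> is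
  the componentwise product, \<open>x ^ k\<close> (for natural \<open>k\<close>) the componentwise power, and \<open>1\<close> the
  vector with all entries equal to one.
\<close>

text \<open>
  Componentwise power with a real exponent. As for \<open>powr\<close>, it is meaningful only for
  nonnegative entries (positive entries if the exponent is negative).
\<close>

definition vpowr :: "real ^ 'n \<Rightarrow> real \<Rightarrow> real ^ 'n"  (infixr "vpowr" 80)
  where "x vpowr r = (\<chi> i. (x $ i) powr r)"

text \<open>The gradient is unspecified where the function is not differentiable.\<close>

definition grad :: "(real ^ 'n \<Rightarrow> real) \<Rightarrow> real ^ 'n \<Rightarrow> real ^ 'n"
  where "grad f x = (THE D. GDERIV f x :> D)"

text \<open>Row \<open>i\<close>, column \<open>j\<close> holds the \<open>j\<close>-th partial derivative of the \<open>i\<close>-th partial derivative.\<close>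

definition hess :: "(real ^ 'n \<Rightarrow> real) \<Rightarrow> real ^ 'n \<Rightarrow> real ^ 'n ^ 'n"
  where "hess f x = jacobian (grad f) (at x)"

definition C2 :: "(real ^ 'n \<Rightarrow> real) \<Rightarrow> bool"
  where "C2 f \<longleftrightarrow> (\<forall>x. f differentiable (at x)) \<and> (\<forall>x. grad f differentiable (at x))
                 \<and> continuous_on UNIV (hess f)"

text \<open>
  The Loewner order, meant for symmetric matrices; the library's \<open>\<le>\<close> on matrices is entrywise.
\<close>

definition loewner_le :: "real ^ 'n ^ 'n \<Rightarrow> real ^ 'n ^ 'n \<Rightarrow> bool"
  where "loewner_le A B \<longleftrightarrow> (\<forall>v. v \<bullet> (A *v v) \<le> v \<bullet> (B *v v))"

end

theory Submission
  imports Defs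
begin

text \<open>
  Put \<open>a = sqrt \<alpha>\<close>, \<open>s = \<gamma> / \<epsilon>\<close> and \<open>A = hess \<L> 0\<close>, which is symmetric by Young's theorem. Near the
  origin and for large times the preconditioner is close to \<open>s\<close>, so in the variables \<open>x = \<Theta>\<close>,
  \<open>y = \<Theta> + s *\<^sub>R m\<close> the dynamics is a small perturbation of \<open>(x, y) \<mapsto> (B x - \<alpha> *\<^sub>R y, x)\<close> with
  \<open>B = (1 + \<alpha>) I - s (1 - \<alpha>) A\<close>. The hypotheses on \<open>\<alpha>\<close> and \<open>\<gamma>\<close> say precisely that
  \<open>- 2 a I \<le> B \<le> 2 a I\<close>, so that \<open>\<bar>x\<bar>\<^sup>2 - x \<bullet> B y + a\<^sup>2 \<bar>y\<bar>\<^sup>2\<close> is nonnegative; it is multiplied by exactly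
  \<open>a\<^sup>2\<close> in every step. A slight modification is a definite Lyapunov function with rate arbitrarily close
  to \<open>a\<^sup>2\<close>, which tolerates small relative errors. During the finitely many initial steps with a large
  bias correction it grows at most by a fixed factor, which is absorbed by choosing \<open>\<eta>\<close> small.
\<close>

section \<open>Symmetry of the second derivative\<close>

text \<open>Mean value theorem for the increment of \<open>f\<close> by \<open>v\<close> as its base
  point moves along \<open>u\<close>: the derivative pairs \<open>u\<close> with a difference of two
  gradients within \<open>norm u + norm v\<close> of \<open>a\<close>. Linearizing each of them at
  \<open>a\<close> costs one error term.\<close>

lemma second_difference_bound:
  fixes f :: "'a::real_inner \<Rightarrow> real"
  assumes grad: "\<And>x. GDERIV f x :> g x"
    and A: "linear A"
    and close: "\<And>y. norm (y - a) < d \<Longrightarrow> norm (g y - g a - A (y - a)) \<le> e * norm (y - a)"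
    and e: "0 \<le> e" and uv: "norm u + norm v < d"
  shows "\<bar>f (a + u + v) - f (a + u) - f (a + v) + f a - u \<bullet> A v\<bar> \<le> 2 * e * norm u * (norm u + norm v)"
proof -
  define \<phi> where "\<phi> t = f (a + t *\<^sub>R u + v) - f (a + t *\<^sub>R u)" for t :: real
  have der: "(\<phi> has_real_derivative u \<bullet> (g (a + t *\<^sub>R u + v) - g (a + t *\<^sub>R u))) (at t)" for t
  proof -
    have *: "((\<lambda>t. f (w + t *\<^sub>R u)) has_real_derivative u \<bullet> g (w + t *\<^sub>R u)) (at t)" for w
    proof -
      have "((\<lambda>t. w + t *\<^sub>R u) has_derivative (\<lambda>h. h *\<^sub>R u)) (at t)"
        by (auto intro!: derivative_eq_intros)
      from has_derivative_compose[OF this grad[of "w + t *\<^sub>R u", unfolded gderiv_def]]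
      show ?thesis
        by (simp add: has_field_derivative_def mult_commute_abs)
    qed
    from DERIV_diff[OF *[of "a + v"] *[of a]] show ?thesis
      unfolding \<phi>_def by (simp add: inner_diff_right algebra_simps)
  qed
  obtain t where t: "0 < t" "t < 1" and mvt: "\<phi> 1 - \<phi> 0 = u \<bullet> (g (a + t *\<^sub>R u + v) - g (a + t *\<^sub>R u))"
    using MVT2[of 0 1 \<phi>, OF _ der] by auto
  let ?r = "\<lambda>w. g (a + w) - g a - A w"
  have r: "norm (?r w) \<le> e * (norm u + norm v)" if "norm w \<le> norm u + norm v" for w
  proof -
    have "norm (?r w) \<le> e * norm w" using close[of "a + w"] that uv by simp
    also have "\<dots> \<le> e * (norm u + norm v)" using that e by (rule mult_left_mono)
    finally show ?thesis .
  qed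
  have tu: "norm (t *\<^sub>R u) \<le> norm u" using t by (simp add: mult_left_le_one_le)
  have tuv: "norm (t *\<^sub>R u + v) \<le> norm u + norm v"
    using norm_triangle_ineq[of "t *\<^sub>R u" v] tu by linarith
  have err: "?r (t *\<^sub>R u + v) - ?r (t *\<^sub>R u) = g (a + t *\<^sub>R u + v) - g (a + t *\<^sub>R u) - A v"
    by (simp add: linear_add[OF A] add.assoc)
  have "f (a + u + v) - f (a + u) - f (a + v) + f a - u \<bullet> A v
      = u \<bullet> (?r (t *\<^sub>R u + v) - ?r (t *\<^sub>R u))"
    unfolding err using mvt unfolding \<phi>_def by (simp add: inner_diff_right)
  also have "\<bar>\<dots>\<bar> \<le> norm u * norm (?r (t *\<^sub>R u + v) - ?r (t *\<^sub>R u))"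
    by (rule Cauchy_Schwarz_ineq2)
  also have "\<dots> \<le> norm u * (e * (norm u + norm v) + e * (norm u + norm v))"
    using r[OF tuv] r[of "t *\<^sub>R u"] tu norm_ge_zero[of v]
      norm_triangle_ineq4[of "?r (t *\<^sub>R u + v)" "?r (t *\<^sub>R u)"]
    by (intro mult_left_mono) (linarith | simp)+
  finally show ?thesis by (simp add: algebra_simps)
qed

text \<open>The second difference of \<open>f\<close> is unchanged when its two increments are
  swapped, so after scaling by \<open>t\<close> it is close to both
  \<open>t\<^sup>2 * (u \<bullet> A v)\<close> and \<open>t\<^sup>2 * (v \<bullet> A u)\<close>, up
  to order \<open>e * t\<^sup>2\<close>. Divide by \<open>t\<^sup>2\<close> and let \<open>e\<close>
  tend to 0.\<close>

lemma derivative_of_gradient_symmetric: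
  fixes f :: "'a::real_inner \<Rightarrow> real"
  assumes grad: "\<And>x. GDERIV f x :> g x" and A: "(g has_derivative A) (at a)"
  shows "u \<bullet> A v = A u \<bullet> v"
proof -
  have linA: "linear A" using A by (simp add: has_derivative_linear)
  let ?S = "norm u + norm v"
  have "\<bar>u \<bullet> A v - v \<bullet> A u\<bar> \<le> e * (2 * ?S\<^sup>2)" if e: "e > 0" for e
  proof -
    obtain d where d: "d > 0"
      and close: "\<And>y. norm (y - a) < d \<Longrightarrow> norm (g y - g a - A (y - a)) \<le> e * norm (y - a)"
      using A e unfolding has_derivative_at_alt by blast
    \<comment> \<open>Scales the total length of both increments to at most \<open>d / 2\<close>;
      the \<open>+ 1\<close> covers \<open>u = v = 0\<close>.\<close>
    define t where "t = d / (2 * (?S + 1))"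
    have S0: "0 < ?S + 1" by (smt (verit) norm_ge_zero)
    then have t: "t > 0" using d by (simp add: t_def)
    have "t * ?S < d"
    proof -
      have "t * ?S \<le> t * (?S + 1)" using t by simp
      also have "\<dots> = d / 2" using S0 by (simp add: t_def field_simps)
      finally show ?thesis using d by simp
    qed
    then have small: "norm (t *\<^sub>R u) + norm (t *\<^sub>R v) < d"
      using t by (simp add: distrib_left)
    let ?D = "f (a + t *\<^sub>R u + t *\<^sub>R v) - f (a + t *\<^sub>R u) - f (a + t *\<^sub>R v) + f a"
    have 1: "\<bar>?D - t\<^sup>2 * (u \<bullet> A v)\<bar> \<le> t\<^sup>2 * (2 * e * norm u * ?S)"
      using second_difference_bound[OF grad linA close less_imp_le[OF e] small] t
      by (simp add: linear_scale[OF linA] power2_eq_square algebra_simps)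
    have "norm (t *\<^sub>R v) + norm (t *\<^sub>R u) < d" using small by simp
    from second_difference_bound[OF grad linA close less_imp_le[OF e] this] t
    have 2: "\<bar>?D - t\<^sup>2 * (v \<bullet> A u)\<bar> \<le> t\<^sup>2 * (2 * e * norm v * ?S)"
      by (simp add: linear_scale[OF linA] power2_eq_square algebra_simps)
    have "t\<^sup>2 * \<bar>u \<bullet> A v - v \<bullet> A u\<bar> = \<bar>t\<^sup>2 * (u \<bullet> A v) - t\<^sup>2 * (v \<bullet> A u)\<bar>"
      by (simp add: abs_mult flip: right_diff_distrib)
    also have "\<dots> \<le> t\<^sup>2 * (2 * e * norm u * ?S) + t\<^sup>2 * (2 * e * norm v * ?S)"
      using 1 2 by linarith
    also have "\<dots> = t\<^sup>2 * (e * (2 * ?S\<^sup>2))" by (simp add: power2_eq_square algebra_simps)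
    finally show ?thesis using t by simp
  qed
  then have "((\<lambda>e. e * (2 * ?S\<^sup>2)) \<longlongrightarrow> 0) (at_right 0) \<Longrightarrow> \<bar>u \<bullet> A v - v \<bullet> A u\<bar> \<le> 0"
    by (intro tendsto_lowerbound[where F = "at_right (0::real)"])
      (auto simp: eventually_at_right_less eventually_at_filter)
  moreover have "((\<lambda>e. e * (2 * ?S\<^sup>2)) \<longlongrightarrow> 0) (at_right 0)"
    by (auto intro!: tendsto_eq_intros)
  ultimately have "\<bar>u \<bullet> A v - v \<bullet> A u\<bar> \<le> 0" by blast
  then show ?thesis by (simp add: inner_commute)
qed

section \<open>A Lyapunov form for the linear second-order recursion\<close>

text \<open>Polarization and the parallelogram law carry the bound from the quadratic to the
  bilinear form; on unit vectors this gives exactly \<open>b\<close>, and homogeneity does the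
  rest.\<close>

lemma symmetric_form_bound:
  fixes B :: "'a::real_inner \<Rightarrow> 'a"
  assumes B: "linear B" and sym: "\<And>x y. x \<bullet> B y = B x \<bullet> y"
    and bnd: "\<And>x. \<bar>x \<bullet> B x\<bar> \<le> b * (x \<bullet> x)"
  shows "\<bar>x \<bullet> B y\<bar> \<le> b * norm x * norm y"
proof (cases "x = 0 \<or> y = 0")
  case True
  then show ?thesis using linear_0[OF B] by auto
next
  case False
  have *: "2 * \<bar>u \<bullet> B v\<bar> \<le> b * (u \<bullet> u + v \<bullet> v)" for u v
  proof -
    have "4 * (u \<bullet> B v) = (u + v) \<bullet> B (u + v) - (u - v) \<bullet> B (u - v)"
      using sym[of u v] by (simp add: linear_add[OF B] linear_diff[OF B] inner_simps inner_commute)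
    moreover have "(u + v) \<bullet> (u + v) + (u - v) \<bullet> (u - v) = 2 * (u \<bullet> u + v \<bullet> v)"
      by (simp add: inner_simps inner_commute)
    then have "b * ((u + v) \<bullet> (u + v)) + b * ((u - v) \<bullet> (u - v)) = 2 * (b * (u \<bullet> u + v \<bullet> v))"
      by (metis distrib_left mult.left_commute)
    ultimately show ?thesis using bnd[of "u + v"] bnd[of "u - v"] by linarith
  qed
  have "\<bar>sgn x \<bullet> B (sgn y)\<bar> \<le> b"
    using *[of "sgn x" "sgn y"] False by (simp add: dot_square_norm norm_sgn)
  then show ?thesis using False
    by (simp add: sgn_div_norm linear_scale[OF B] abs_mult field_simps)
qed

text \<open>With \<open>\<mu> = 0\<close> the form would merely be multiplied by \<open>a\<^sup>2\<close> along the linear recursion, but it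
  would be degenerate as soon as \<open>2 * a\<close> is an eigenvalue of \<open>B\<close> (a Jordan block). The summand
  \<open>\<mu> * (y \<bullet> y)\<close> restores definiteness at the cost of replacing \<open>a\<close> by a larger rate.\<close>

definition momentum_form :: "('a::real_inner \<Rightarrow> 'a) \<Rightarrow> real \<Rightarrow> real \<Rightarrow> 'a \<Rightarrow> 'a \<Rightarrow> real"
  where "momentum_form B a \<mu> x y = x \<bullet> x - x \<bullet> B y + (a\<^sup>2 + \<mu>) * (y \<bullet> y)"

lemma momentum_form_lower:
  assumes "\<bar>x \<bullet> B y\<bar> \<le> 2 * a * norm x * norm y"
  shows "(norm x - a * norm y)\<^sup>2 + \<mu> * (norm y)\<^sup>2 \<le> momentum_form B a \<mu> x y"
  using assms by (simp add: momentum_form_def dot_square_norm power2_eq_square algebra_simps abs_le_iff)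

lemma momentum_form_upper:
  assumes "\<bar>x \<bullet> B y\<bar> \<le> 2 * a * norm x * norm y"
  shows "momentum_form B a \<mu> x y \<le> (norm x + a * norm y)\<^sup>2 + \<mu> * (norm y)\<^sup>2"
  using assms by (simp add: momentum_form_def dot_square_norm power2_eq_square algebra_simps abs_le_iff)

text \<open>Weighted Young inequality: the difference of the sides is a perfect square over
  \<open>t\<close>.\<close>

lemma square_le_of_close:
  fixes r s t :: real
  assumes "t > 0"
  shows "r\<^sup>2 \<le> (1 + t) * s\<^sup>2 + (1 + 1 / t) * (r - s)\<^sup>2"
proof -
  have "(1 + t) * s\<^sup>2 + (1 + 1 / t) * (r - s)\<^sup>2 - r\<^sup>2 = (t * s - (r - s))\<^sup>2 / t"
    using assms by (simp add: power2_eq_square field_simps)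
  also have "\<dots> \<ge> 0" using assms by simp
  finally show ?thesis by simp
qed

text \<open>Only the summand \<open>\<mu> * (x \<bullet> x)\<close> needs an estimate. The form with
  weight 0 dominates \<open>(norm x - a * norm y)\<^sup>2\<close>, so Young's inequality trades
  \<open>norm x\<close> for \<open>a * norm y\<close>; the condition on \<mu> absorbs the remainder
  into \<open>t * a\<^sup>2\<close> times that form.\<close>

lemma momentum_form_step:
  assumes B: "\<And>x y. x \<bullet> B y = B x \<bullet> y"
    and bnd: "\<And>x y. \<bar>x \<bullet> B y\<bar> \<le> 2 * a * norm x * norm y"
    and t: "0 < t" and \<mu>: "0 < \<mu>" "\<mu> * (1 + 1 / t) \<le> t * a\<^sup>2"
  shows "momentum_form B a \<mu> (B x - a\<^sup>2 *\<^sub>R y) x \<le> (1 + t) * a\<^sup>2 * momentum_form B a \<mu> x y"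
proof -
  let ?V = "momentum_form B a 0 x y"
  have "norm x ^ 2 \<le> (1 + t) * (a * norm y)\<^sup>2 + (1 + 1 / t) * (norm x - a * norm y)\<^sup>2"
    by (rule square_le_of_close[OF t])
  also have "\<dots> \<le> (1 + t) * (a * norm y)\<^sup>2 + (1 + 1 / t) * ?V"
    using momentum_form_lower[where B = B and \<mu> = 0, OF bnd, of x y] t by (simp add: mult_left_mono)
  finally have x: "\<mu> * norm x ^ 2 \<le> \<mu> * ((1 + t) * (a * norm y)\<^sup>2 + (1 + 1 / t) * ?V)"
    using \<mu> by simp
  have V0: "0 \<le> ?V"
    using momentum_form_lower[where B = B and \<mu> = 0, OF bnd, of x y] by (smt (verit) zero_le_power2 mult_zero_left)
  have "momentum_form B a \<mu> (B x - a\<^sup>2 *\<^sub>R y) x = a\<^sup>2 * ?V + \<mu> * norm x ^ 2"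
  proof -
    have e: "B x \<bullet> y = x \<bullet> B y" "y \<bullet> B x = x \<bullet> B y" using B[of x y] by (simp_all add: inner_commute)
    show ?thesis
      by (simp add: momentum_form_def inner_diff_left inner_diff_right e power2_norm_eq_inner algebra_simps)
  qed
  also have "\<dots> \<le> a\<^sup>2 * ?V + \<mu> * ((1 + t) * (a * norm y)\<^sup>2) + (\<mu> * (1 + 1 / t)) * ?V"
    using x by (simp add: algebra_simps)
  also have "\<dots> \<le> a\<^sup>2 * ?V + \<mu> * ((1 + t) * (a * norm y)\<^sup>2) + (t * a\<^sup>2) * ?V"
    using mult_right_mono[OF \<mu>(2) V0] by simp
  also have "\<dots> = (1 + t) * a\<^sup>2 * momentum_form B a \<mu> x y"
    by (simp add: momentum_form_def dot_square_norm power_mult_distrib algebra_simps)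
  finally show ?thesis .
qed

text \<open>Young's inequality for a nonnegative quadratic form: the difference of the sides is
  again a value of the form, divided by \<sigma>.\<close>

lemma momentum_form_add_le:
  assumes B: "linear B" and \<sigma>: "0 < \<sigma>" and nonneg: "\<And>x y. 0 \<le> momentum_form B a \<mu> x y"
  shows "momentum_form B a \<mu> (x + u) (y + v)
    \<le> (1 + \<sigma>) * momentum_form B a \<mu> x y + (1 + 1 / \<sigma>) * momentum_form B a \<mu> u v"
proof -
  let ?W = "momentum_form B a \<mu>"
  have "(1 + \<sigma>) * ?W x y + (1 + 1 / \<sigma>) * ?W u v - ?W (x + u) (y + v)
      = ?W (\<sigma> *\<^sub>R x - u) (\<sigma> *\<^sub>R y - v) / \<sigma>"
    using \<sigma> by (simp add: momentum_form_def inner_simps linear_add[OF B] linear_diff[OF B]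
        linear_scale[OF B] inner_commute field_simps)
  also have "\<dots> \<ge> 0" using \<sigma> nonneg by simp
  finally show ?thesis by simp
qed

text \<open>Errors are measured relative to the state. Small ones still allow the rate
  \<open>q\<close>, which serves late times; arbitrary ones cost a fixed factor, which serves the
  initial steps, where the bias correction may be far from 1.\<close>

lemma momentum_lyapunov:
  fixes B :: "'a::real_inner \<Rightarrow> 'a"
  assumes B: "linear B" and sym: "\<And>x y. x \<bullet> B y = B x \<bullet> y"
    and bnd: "\<And>x. \<bar>x \<bullet> B x\<bar> \<le> 2 * a * (x \<bullet> x)"
    and a: "0 < a" "a < q"
  obtains W C \<rho> where "0 < C" "0 < \<rho>"
    and "\<And>x y. (norm x)\<^sup>2 + (norm y)\<^sup>2 \<le> C * W x y"
    and "\<And>x y. W x y \<le> C * ((norm x)\<^sup>2 + (norm y)\<^sup>2)"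
    and "\<And>x y u v. \<lbrakk>norm u \<le> \<rho> * (norm x + norm y); norm v \<le> \<rho> * (norm x + norm y)\<rbrakk>
           \<Longrightarrow> W (B x - a\<^sup>2 *\<^sub>R y + u) (x + v) \<le> q\<^sup>2 * W x y"
    and "\<And>R. \<exists>L. \<forall>x y u v. norm u \<le> R * (norm x + norm y) \<longrightarrow> norm v \<le> R * (norm x + norm y)
           \<longrightarrow> W (B x - a\<^sup>2 *\<^sub>R y + u) (x + v) \<le> L * W x y"
proof -
  have bnd': "\<bar>x \<bullet> B y\<bar> \<le> 2 * a * norm x * norm y" for x y
    using symmetric_form_bound[OF B sym bnd] by (simp add: mult.assoc)
  have aq: "a\<^sup>2 < q\<^sup>2" using a by (simp add: power_strict_mono)
  \<comment> \<open>Puts \<theta>, the factor \<open>(1 + t) * a\<^sup>2\<close> without errors,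
    midway between \<open>a\<^sup>2\<close> and \<open>q\<^sup>2\<close>; the rest of the gap is
    left for errors. \<mu> then turns the condition of \<open>momentum_form_step\<close> into an
    equality.\<close>
  define t where "t = (q\<^sup>2 / a\<^sup>2 - 1) / 2"
  have t: "0 < t" using aq a by (simp add: t_def field_simps)
  define \<mu> where "\<mu> = t * a\<^sup>2 / (1 + 1 / t)"
  have \<mu>: "0 < \<mu>" "\<mu> * (1 + 1 / t) \<le> t * a\<^sup>2"
    using t a by (simp_all add: \<mu>_def field_simps add_pos_pos)
  define \<theta> where "\<theta> = (1 + t) * a\<^sup>2"
  have \<theta>: "0 < \<theta>" "\<theta> < q\<^sup>2"
  proof -
    have "\<theta> = (q\<^sup>2 + a\<^sup>2) / 2" using a by (simp add: \<theta>_def t_def field_simps)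
    moreover have "0 < a\<^sup>2" using a by simp
    ultimately show "0 < \<theta>" using aq by (smt (verit) half_gt_zero)
    show "\<theta> < q\<^sup>2" using \<open>\<theta> = (q\<^sup>2 + a\<^sup>2) / 2\<close> aq by simp
  qed
  define W where "W = momentum_form B a \<mu>"
  have lower: "(norm x - a * norm y)\<^sup>2 + \<mu> * (norm y)\<^sup>2 \<le> W x y" for x y
    unfolding W_def by (rule momentum_form_lower[OF bnd'])
  have W0: "0 \<le> W x y" for x y
    using lower[of x y] \<mu>(1) by (smt (verit) mult_nonneg_nonneg zero_le_power2)
  have step: "W (B x - a\<^sup>2 *\<^sub>R y) x \<le> \<theta> * W x y" for x y
    unfolding W_def \<theta>_def by (rule momentum_form_step[OF sym bnd' t \<mu>])
  define C where "C = (2 + (2 * a\<^sup>2 + 1) / \<mu>) + (2 + (2 * a\<^sup>2 + \<mu>))"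
  have C: "0 < C" using \<mu> a by (simp add: C_def add_pos_pos)
  have CW: "(norm x)\<^sup>2 + (norm y)\<^sup>2 \<le> C * W x y" for x y
  proof -
    have "\<mu> * norm y ^ 2 \<le> W x y"
      using lower[of x y] by (smt (verit) zero_le_power2)
    then have "norm y ^ 2 \<le> W x y / \<mu>" using \<mu>(1) by (simp add: field_simps)
    then have y: "(2 * a\<^sup>2 + 1) * norm y ^ 2 \<le> (2 * a\<^sup>2 + 1) * (W x y / \<mu>)"
      by (rule mult_left_mono) simp
    have "norm x ^ 2 \<le> 2 * (a * norm y)\<^sup>2 + 2 * (norm x - a * norm y)\<^sup>2"
      using square_le_of_close[of 1 "norm x" "a * norm y"] by simp
    also have "\<dots> \<le> 2 * (a * norm y)\<^sup>2 + 2 * W x y"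
      using lower[of x y] \<mu>(1) by (smt (verit) mult_nonneg_nonneg zero_le_power2)
    finally have "(norm x)\<^sup>2 + (norm y)\<^sup>2 \<le> (2 * a\<^sup>2 + 1) * norm y ^ 2 + 2 * W x y"
      by (simp add: power_mult_distrib algebra_simps)
    also have "\<dots> \<le> (2 + (2 * a\<^sup>2 + 1) / \<mu>) * W x y"
      using y by (simp add: algebra_simps add_divide_distrib)
    also have "\<dots> \<le> C * W x y"
      using W0 \<mu>(1) by (intro mult_right_mono) (simp_all add: C_def)
    finally show ?thesis .
  qed
  have WC: "W x y \<le> C * ((norm x)\<^sup>2 + (norm y)\<^sup>2)" for x y
  proof -
    have "W x y \<le> (norm x + a * norm y)\<^sup>2 + \<mu> * (norm y)\<^sup>2"
      unfolding W_def by (rule momentum_form_upper[OF bnd'])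
    also have "\<dots> \<le> 2 * (norm x)\<^sup>2 + (2 * a\<^sup>2 + \<mu>) * (norm y)\<^sup>2"
      using zero_le_power2[of "norm x - a * norm y"] by (simp add: power2_eq_square algebra_simps)
    also have "\<dots> \<le> C * (norm x)\<^sup>2 + C * (norm y)\<^sup>2"
      using \<mu>(1) by (intro add_mono mult_right_mono) (simp_all add: C_def add_nonneg_nonneg)
    finally show ?thesis by (simp add: distrib_left)
  qed
  \<comment> \<open>Errors of relative size \<open>r\<close> enter as \<open>r\<^sup>2\<close> times
    a multiple of \<open>W x y\<close>. With \<open>r = \<rho>\<close> this gives the contraction,
    with \<open>r = R\<close> the growth bound.\<close>
  have perturb: "W (B x - a\<^sup>2 *\<^sub>R y + u) (x + v)
      \<le> ((1 + \<sigma>) * \<theta> + (1 + 1 / \<sigma>) * (4 * C\<^sup>2) * r\<^sup>2) * W x y"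
    if "norm u \<le> r * (norm x + norm y)" "norm v \<le> r * (norm x + norm y)" "0 < \<sigma>"
    for x y u v r \<sigma>
  proof -
    have sq: "(norm w)\<^sup>2 \<le> 2 * r\<^sup>2 * (C * W x y)" if "norm w \<le> r * (norm x + norm y)" for w :: 'a
    proof -
      have "(norm w)\<^sup>2 \<le> (r * (norm x + norm y))\<^sup>2" using that by (simp add: power_mono)
      also have "\<dots> = r\<^sup>2 * (norm x + norm y)\<^sup>2" by (rule power_mult_distrib)
      also have "\<dots> \<le> r\<^sup>2 * (2 * ((norm x)\<^sup>2 + (norm y)\<^sup>2))"
        using zero_le_power2[of "norm x - norm y"]
        by (intro mult_left_mono) (simp_all add: power2_eq_square algebra_simps)
      also have "\<dots> \<le> r\<^sup>2 * (2 * (C * W x y))"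
        using CW by (intro mult_left_mono) simp_all
      finally show ?thesis by simp
    qed
    have "W u v \<le> C * ((norm u)\<^sup>2 + (norm v)\<^sup>2)" by (rule WC)
    also have "\<dots> \<le> C * (4 * r\<^sup>2 * (C * W x y))"
      using sq[OF that(1)] sq[OF that(2)] C by (intro mult_left_mono) simp_all
    finally have uv: "W u v \<le> 4 * C\<^sup>2 * r\<^sup>2 * W x y" by (simp add: power2_eq_square algebra_simps)
    have "W (B x - a\<^sup>2 *\<^sub>R y + u) (x + v)
        \<le> (1 + \<sigma>) * W (B x - a\<^sup>2 *\<^sub>R y) x + (1 + 1 / \<sigma>) * W u v"
      using W0 unfolding W_def by (intro momentum_form_add_le[OF B that(3)]) 
    also have "\<dots> \<le> (1 + \<sigma>) * (\<theta> * W x y) + (1 + 1 / \<sigma>) * (4 * C\<^sup>2 * r\<^sup>2 * W x y)"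
      using step uv that(3) by (intro add_mono mult_left_mono) simp_all
    finally show ?thesis by (simp add: algebra_simps)
  qed
  \<comment> \<open>\<sigma> uses half of the gap between \<theta> and \<open>q\<^sup>2\<close>;
    \<rho> exhausts the other half.\<close>
  define \<sigma> where "\<sigma> = (q\<^sup>2 / \<theta> - 1) / 2"
  have \<sigma>: "0 < \<sigma>" "(1 + \<sigma>) * \<theta> < q\<^sup>2" using \<theta> by (simp_all add: \<sigma>_def field_simps)
  define Z where "Z = (1 + 1 / \<sigma>) * (4 * C\<^sup>2)"
  have Z: "0 < Z" using \<sigma> C by (simp add: Z_def add_pos_pos)
  define \<rho> where "\<rho> = sqrt ((q\<^sup>2 - (1 + \<sigma>) * \<theta>) / Z)"
  have \<rho>: "0 < \<rho>" using Z \<sigma>(2) by (simp add: \<rho>_def)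
  have "\<rho>\<^sup>2 = (q\<^sup>2 - (1 + \<sigma>) * \<theta>) / Z" using Z \<sigma>(2) by (simp add: \<rho>_def)
  then have q_eq: "(1 + \<sigma>) * \<theta> + Z * \<rho>\<^sup>2 = q\<^sup>2" using Z by simp
  show thesis
  proof (rule that[OF C \<rho> CW WC])
    show "W (B x - a\<^sup>2 *\<^sub>R y + u) (x + v) \<le> q\<^sup>2 * W x y"
      if "norm u \<le> \<rho> * (norm x + norm y)" "norm v \<le> \<rho> * (norm x + norm y)" for x y u v
      using perturb[OF that \<sigma>(1)] q_eq by (simp add: Z_def)
    show "\<exists>L. \<forall>x y u v. norm u \<le> R * (norm x + norm y) \<longrightarrow> norm v \<le> R * (norm x + norm y)
           \<longrightarrow> W (B x - a\<^sup>2 *\<^sub>R y + u) (x + v) \<le> L * W x y" for R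
      using perturb[OF _ _ \<sigma>(1)] by blast
  qed
qed

section \<open>Bootstrap argument\<close>

text \<open>The estimates for \<open>w\<close> hold only while all past \<open>z k\<close> stay
  below \<open>r\<close>, and \<open>z\<close> is itself controlled by \<open>w\<close>. Strong
  induction resolves the circle: at most \<open>N\<close> steps can grow, so \<open>w\<close> never
  exceeds \<open>(L / q) ^ N * w 0\<close>, which is small enough to keep \<open>z\<close> below
  \<open>r\<close>.\<close>

lemma eventually_contracting_bound:
  fixes w z :: "nat \<Rightarrow> real"
  assumes q: "0 < q" "q \<le> 1" and L: "1 \<le> L"
    and small: "\<And>n. z n \<le> K * w n" and w0: "K * (L / q) ^ N * w 0 \<le> r" and K: "0 \<le> K"
    and nonneg: "0 \<le> w 0"
    and grow: "\<And>n. (\<And>k. k \<le> n \<Longrightarrow> z k \<le> r) \<Longrightarrow> w (Suc n) \<le> L * w n"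
    and contract: "\<And>n. N \<le> n \<Longrightarrow> (\<And>k. k \<le> n \<Longrightarrow> z k \<le> r) \<Longrightarrow> w (Suc n) \<le> q * w n"
  shows "w n \<le> (L / q) ^ N * q ^ n * w 0"
proof -
  have Lq: "1 \<le> L / q" using q L by simp
  \<comment> \<open>\<open>min n N\<close> counts the growing steps so far; each is booked as
    \<open>q\<close> times the excess \<open>L / q\<close>.\<close>
  have "w n \<le> (L / q) ^ min n N * q ^ n * w 0 \<and> z n \<le> r" for n
  proof (induction n rule: less_induct)
    case (less n)
    have bound: "w n \<le> (L / q) ^ min n N * q ^ n * w 0"
    proof (cases n)
      case 0
      then show ?thesis by simp
    next
      case (Suc p)
      have hist: "z k \<le> r" if "k \<le> p" for k using less Suc that by simp
      have wp: "w p \<le> (L / q) ^ min p N * q ^ p * w 0" using less Suc by simp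
      show ?thesis
      proof (cases "p < N")
        case True
        have "w n \<le> L * w p" using grow[OF hist] Suc by simp
        also have "\<dots> \<le> L * ((L / q) ^ min p N * q ^ p * w 0)"
          using wp L by (intro mult_left_mono) simp_all
        also have "\<dots> = (L / q) ^ min n N * q ^ n * w 0"
          using True Suc q by (simp add: min_def field_simps)
        finally show ?thesis .
      next
        case False
        have "w n \<le> q * w p" using contract[OF _ hist] Suc False by simp
        also have "\<dots> \<le> q * ((L / q) ^ min p N * q ^ p * w 0)"
          using wp q by (intro mult_left_mono) simp_all
        also have "\<dots> = (L / q) ^ min n N * q ^ n * w 0"
          using False Suc by (simp add: min_def)
        finally show ?thesis .
      qed
    qed
    have "z n \<le> K * w n" by (rule small)
    also have "\<dots> \<le> K * ((L / q) ^ N * 1 * w 0)"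
    proof -
      have "(L / q) ^ min n N * q ^ n * w 0 \<le> (L / q) ^ N * 1 * w 0"
        using Lq q nonneg
        by (intro mult_right_mono mult_mono power_increasing power_le_one) auto
      then show ?thesis using bound K by (intro mult_left_mono) linarith+
    qed
    finally show ?case using bound w0 by (simp add: mult.assoc)
  qed
  moreover have "(L / q) ^ min n N * q ^ n * w 0 \<le> (L / q) ^ N * q ^ n * w 0"
    using Lq q nonneg by (intro mult_right_mono power_increasing) auto
  ultimately show ?thesis by (meson order_trans)
qed

section \<open>Gradient, second moment and preconditioner\<close>

text \<open>\<open>adjoint f' 1\<close> is the Riesz vector of the derivative; uniqueness of
  derivatives identifies it with the described value.\<close>

lemma GDERIV_grad:
  assumes "f differentiable (at x)"
  shows "GDERIV f x :> grad f x"
proof -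
  obtain f' where f': "(f has_derivative f') (at x)" using assms unfolding differentiable_def by blast
  then have "linear f'" by (rule has_derivative_linear)
  then have "f' = (\<lambda>h. h \<bullet> adjoint f' 1)" using adjoint_works[of f' _ 1] by (auto simp: fun_eq_iff)
  with f' have D: "GDERIV f x :> adjoint f' 1" unfolding gderiv_def by metis
  then have "E = adjoint f' 1" if "GDERIV f x :> E" for E
    using has_derivative_unique that unfolding gderiv_def by (metis vector_eq_ldot)
  with D show ?thesis unfolding grad_def by (rule theI)
qed

lemma has_derivative_grad_hess:
  assumes "grad f differentiable (at x)"
  shows "(grad f has_derivative (*v) (hess f x)) (at x)"
  using assms unfolding hess_def jacobian_works .

text \<open>Unrolled, \<open>v n\<close> is a sum of squares with nonnegative weights of total
  \<open>1 - \<beta> ^ n\<close>. The bias correction divides out exactly this factor.\<close>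

lemma second_moment_bounds:
  fixes v g :: "nat \<Rightarrow> real"
  assumes \<beta>: "0 \<le> \<beta>" "\<beta> \<le> 1" and v0: "v 0 = 0"
    and rec: "\<And>n. v (Suc n) = \<beta> * v n + (1 - \<beta>) * (g n)\<^sup>2"
    and g: "\<And>k. k < n \<Longrightarrow> \<bar>g k\<bar> \<le> R"
  shows "0 \<le> v n \<and> v n \<le> (1 - \<beta> ^ n) * R\<^sup>2"
  using g
proof (induction n)
  case 0
  then show ?case by (simp add: v0)
next
  case (Suc n)
  then have IH: "0 \<le> v n" "v n \<le> (1 - \<beta> ^ n) * R\<^sup>2" and gn: "\<bar>g n\<bar> \<le> R" by auto
  have "(g n)\<^sup>2 \<le> R\<^sup>2" using gn by (simp add: abs_le_square_iff[symmetric])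
  then have "\<beta> * v n + (1 - \<beta>) * (g n)\<^sup>2 \<le> \<beta> * ((1 - \<beta> ^ n) * R\<^sup>2) + (1 - \<beta>) * R\<^sup>2"
    using IH \<beta> by (intro add_mono mult_left_mono) auto
  moreover have "0 \<le> \<beta> * v n + (1 - \<beta>) * (g n)\<^sup>2" using IH(1) \<beta> by simp
  moreover have "\<beta> * ((1 - \<beta> ^ n) * R\<^sup>2) + (1 - \<beta>) * R\<^sup>2 = (1 - \<beta> ^ Suc n) * R\<^sup>2"
    by (simp add: algebra_simps)
  ultimately show ?case by (simp only: rec simp_thms)
qed

text \<open>In use, \<open>b\<close> is \<open>1 - \<beta> ^ n\<close> and \<open>t\<close> is the
  bias correction of the momentum. The deviation from \<open>\<gamma> / \<epsilon>\<close> has two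
  sources: \<open>t - 1\<close>, which dies out with time, and \<open>R\<close>, which is small near
  the origin.\<close>

lemma preconditioner_bounds:
  fixes \<epsilon> b v R s t :: real
  assumes "0 < \<epsilon>" "0 \<le> R" "0 < b" "0 \<le> v" "v \<le> b * R\<^sup>2" "0 \<le> \<gamma>" "1 \<le> t"
  shows "\<bar>\<gamma> * t * (\<epsilon> + b powr (-1/2) * v powr (1/2)) powr (-1) - \<gamma> / \<epsilon>\<bar>
    \<le> \<gamma> / \<epsilon> * (t - 1) + \<gamma> * R / \<epsilon>\<^sup>2"
proof -
  define S where "S = b powr (-1/2) * v powr (1/2)"
  have "S = sqrt (v / b)"
    using assms by (simp add: S_def powr_half_sqrt powr_minus_divide real_sqrt_divide)
  moreover have "sqrt (v / b) \<le> R" using assms by (intro real_le_lsqrt) (auto simp: field_simps)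
  ultimately have S: "0 \<le> S" "S \<le> R" using assms by auto
  have "1 / (\<epsilon> + S) \<le> 1 / \<epsilon>" using assms S by (simp add: frac_le)
  moreover have "1 / \<epsilon> - 1 / (\<epsilon> + S) \<le> R / \<epsilon>\<^sup>2"
  proof -
    have "1 / \<epsilon> - 1 / (\<epsilon> + S) = S / (\<epsilon> * (\<epsilon> + S))" using assms S by (simp add: field_simps)
    also have "\<dots> \<le> R / (\<epsilon> * \<epsilon>)" using assms S by (intro frac_le mult_left_mono) auto
    finally show ?thesis by (simp add: power2_eq_square)
  qed
  moreover have "(\<epsilon> + S) powr (-1) = 1 / (\<epsilon> + S)" using assms S by (simp add: powr_neg_one)
  ultimately have D: "(\<epsilon> + S) powr (-1) \<le> 1 / \<epsilon>" "1 / \<epsilon> - (\<epsilon> + S) powr (-1) \<le> R / \<epsilon>\<^sup>2"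
    and D0: "0 \<le> (\<epsilon> + S) powr (-1)"
    by auto
  let ?D = "(\<epsilon> + S) powr (-1)"
  have "\<bar>t * ?D - 1 / \<epsilon>\<bar> \<le> (t - 1) / \<epsilon> + R / \<epsilon>\<^sup>2"
  proof -
    have "(t - 1) * ?D \<le> (t - 1) * (1 / \<epsilon>)" "0 \<le> (t - 1) * ?D"
      using mult_left_mono[OF D(1), of "t - 1"] mult_nonneg_nonneg[of "t - 1", OF _ D0] assms
      by linarith+
    moreover have "t * x = (t - 1) * x + x" for x by (simp add: algebra_simps)
    then have "t * ?D = (t - 1) * ?D + ?D" .
    moreover have "0 \<le> R / \<epsilon>\<^sup>2" using assms by simp
    moreover have "(t - 1) / \<epsilon> = (t - 1) * (1 / \<epsilon>)" by simp
    ultimately show ?thesis using D by linarith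
  qed
  then have "\<gamma> * \<bar>t * ?D - 1 / \<epsilon>\<bar> \<le> \<gamma> * ((t - 1) / \<epsilon> + R / \<epsilon>\<^sup>2)"
    using assms by (intro mult_left_mono) auto
  also have "\<gamma> * ((t - 1) / \<epsilon> + R / \<epsilon>\<^sup>2) = \<gamma> / \<epsilon> * (t - 1) + \<gamma> * R / \<epsilon>\<^sup>2"
    by (simp add: algebra_simps)
  also have "\<gamma> * \<bar>t * ?D - 1 / \<epsilon>\<bar> = \<bar>\<gamma> * (t * ?D - 1 / \<epsilon>)\<bar>" using assms by (simp add: abs_mult)
  also have "\<gamma> * (t * ?D - 1 / \<epsilon>) = \<gamma> * t * ?D - \<gamma> / \<epsilon>"
    by (simp add: right_diff_distrib)
  finally show ?thesis unfolding S_def .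
qed

lemma norm_componentwise_mult_le:
  fixes P w :: "real ^ 'n"
  assumes "\<And>i. \<bar>P $ i\<bar> \<le> p"
  shows "norm (P * w) \<le> p * norm w"
proof -
  have "0 \<le> p" using assms by (meson abs_ge_zero order_trans)
  then have "norm (P * w) \<le> norm (p *\<^sub>R w)"
    using assms by (intro norm_le_componentwise_cart) (simp add: abs_mult mult_right_mono)
  then show ?thesis using \<open>0 \<le> p\<close> by simp
qed

text \<open>With \<open>y = x + s *\<^sub>R m\<close>, the position from which an unpreconditioned step with momentum \<open>m\<close>
  would have led to \<open>x\<close>, a step becomes a perturbation of the linear second-order recursion
  \<open>(x, y) \<mapsto> (B x - \<alpha> *\<^sub>R y, x)\<close>.\<close>

lemma momentum_step_perturbation:
  fixes x m m' P G :: "real ^ 'n"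
  assumes \<alpha>: "0 \<le> \<alpha>" "\<alpha> \<le> 1" and s: "0 < s"
    and m': "m' = \<alpha> *\<^sub>R m + (1 - \<alpha>) *\<^sub>R G"
    and G: "norm G \<le> K * norm x" "norm (G - a) \<le> e * norm x"
    and P: "\<And>i. \<bar>P $ i - s\<bar> \<le> p" and pos: "0 \<le> e" "0 \<le> K"
    and y: "y = x + s *\<^sub>R m"
  obtains u v where
    "x - P * m' = (1 + \<alpha>) *\<^sub>R x - (s * (1 - \<alpha>)) *\<^sub>R a - \<alpha> *\<^sub>R y + u"
    "x - P * m' + s *\<^sub>R m' = x + v"
    "norm u \<le> (p * (1 / s + K) + s * e) * (norm x + norm y)"
    "norm v \<le> (p * (1 / s + K) + s * e) * (norm x + norm y)"
proof
  \<comment> \<open>\<open>v\<close> is the error of replacing \<open>P\<close> by the constant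
    \<open>s\<close>; \<open>u\<close> adds that of replacing the gradient \<open>G\<close> by its
    linear part \<open>a\<close>.\<close>
  define v where "v = - ((P - s *\<^sub>R 1) * m')"
  define u where "u = v - (s * (1 - \<alpha>)) *\<^sub>R (G - a)"
  have Pm: "P * m' = s *\<^sub>R m' - v"
    by (simp add: v_def vec_eq_iff algebra_simps)
  show "x - P * m' = (1 + \<alpha>) *\<^sub>R x - (s * (1 - \<alpha>)) *\<^sub>R a - \<alpha> *\<^sub>R y + u"
    unfolding Pm unfolding u_def m' y by (simp add: vec_eq_iff algebra_simps)
  show "x - P * m' + s *\<^sub>R m' = x + v" by (simp add: Pm)
  let ?N = "norm x + norm y"
  have p: "0 \<le> p" using P by (meson abs_ge_zero order_trans)
  \<comment> \<open>The momentum is recovered from the two positions, so its size is bounded by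
    \<open>norm x + norm y\<close>.\<close>
  have "m = (1 / s) *\<^sub>R (y - x)" using s by (simp add: y)
  then have "norm m \<le> (1 / s) * ?N"
    using s norm_triangle_ineq4[of y x] by (simp add: divide_right_mono)
  then have "\<alpha> * norm m \<le> (1 / s) * ?N"
    using \<alpha> by (meson mult_left_le_one_le norm_ge_zero order_trans)
  moreover have "(1 - \<alpha>) * norm G \<le> K * ?N"
  proof -
    have "(1 - \<alpha>) * norm G \<le> norm G" using \<alpha> by (simp add: mult_left_le_one_le)
    also have "\<dots> \<le> K * ?N" using G(1) pos(2) by (simp add: distrib_left add_increasing2)
    finally show ?thesis .
  qed
  moreover have "norm m' \<le> \<alpha> * norm m + (1 - \<alpha>) * norm G"
    using \<alpha> norm_triangle_ineq[of "\<alpha> *\<^sub>R m" "(1 - \<alpha>) *\<^sub>R G"] by (simp add: m')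
  ultimately have "norm m' \<le> (1 / s + K) * ?N" by (simp add: distrib_right)
  then have "p * norm m' \<le> p * (1 / s + K) * ?N"
    using p by (simp add: mult_left_mono mult.assoc)
  moreover have "norm v \<le> p * norm m'"
    unfolding v_def norm_minus_cancel using P by (intro norm_componentwise_mult_le) simp
  ultimately have v: "norm v \<le> p * (1 / s + K) * ?N" by simp
  have se: "norm ((s * (1 - \<alpha>)) *\<^sub>R (G - a)) \<le> s * e * ?N"
  proof -
    have "norm ((s * (1 - \<alpha>)) *\<^sub>R (G - a)) = s * ((1 - \<alpha>) * norm (G - a))" using s \<alpha> by (simp add: abs_mult)
    also have "\<dots> \<le> s * norm (G - a)" using s \<alpha> by (simp add: mult_left_le_one_le)
    also have "\<dots> \<le> s * (e * ?N)"
      using G(2) s pos(1) by (simp add: distrib_left add_increasing2)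
    finally show ?thesis by simp
  qed
  have "norm u \<le> norm v + norm ((s * (1 - \<alpha>)) *\<^sub>R (G - a))"
    unfolding u_def by (rule norm_triangle_ineq4)
  then show "norm u \<le> (p * (1 / s + K) + s * e) * ?N" using v se by (simp add: distrib_right)
  show "norm v \<le> (p * (1 / s + K) + s * e) * ?N"
    using v s pos by (simp add: distrib_right add_increasing2)
qed

text \<open>The formula for \<open>a\<close> says \<open>1 - a = s * \<kappa> * (1 + a)\<close>.
  Hence \<open>s * (1 - a\<^sup>2) * \<kappa> = (1 - a)\<^sup>2\<close>, while the bound on
  \<open>s\<close> gives \<open>s * (1 - a\<^sup>2) * K \<le> (1 + a)\<^sup>2\<close>. Subtracted
  from \<open>1 + a\<^sup>2\<close>, these limits become \<open>2 * a\<close> and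
  \<open>- 2 * a\<close>.\<close>

lemma momentum_matrix_form_bound:
  fixes A :: "'a::real_inner \<Rightarrow> 'a" and B :: "'a \<Rightarrow> 'a"
  assumes \<kappa>: "0 < \<kappa>" and K: "s\<^sup>2 * (\<kappa> * K) \<le> 1" and s: "0 < s"
    and A: "\<kappa> * (v \<bullet> v) \<le> v \<bullet> A v" "v \<bullet> A v \<le> K * (v \<bullet> v)"
    and a: "a = (1 - s * \<kappa>) / (1 + s * \<kappa>)"
    and B: "\<And>v. B v = (1 + a\<^sup>2) *\<^sub>R v - (s * (1 - a\<^sup>2)) *\<^sub>R A v"
    and "s * \<kappa> \<le> 1"
  shows "\<bar>v \<bullet> B v\<bar> \<le> 2 * a * (v \<bullet> v)"
proof -
  define h where "h = s * \<kappa>"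
  have h: "0 < h" "h \<le> 1" using assms by (simp_all add: h_def)
  have a': "a = (1 - h) / (1 + h)" by (simp add: a h_def)
  have ah: "1 - a = h * (1 + a)" "0 \<le> a" "a < 1"
    unfolding a' using h by (simp_all add: field_simps)
  have a2: "1 - a\<^sup>2 = (1 - a) * (1 + a)" by (simp add: power2_eq_square algebra_simps)
  have s2: "0 \<le> s * (1 - a\<^sup>2)" using s ah by (simp add: a2)
  have lo: "s * (1 - a\<^sup>2) * \<kappa> = (1 - a)\<^sup>2"
  proof -
    have "s * (1 - a\<^sup>2) * \<kappa> = (1 - a) * (h * (1 + a))" by (simp add: a2 h_def)
    then show ?thesis by (simp add: ah(1)[symmetric] power2_eq_square)
  qed
  have hi: "s * (1 - a\<^sup>2) * K \<le> (1 + a)\<^sup>2"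
  proof -
    have e: "1 - a\<^sup>2 = h * (1 + a)\<^sup>2" unfolding a2 ah(1) by (simp add: power2_eq_square)
    have "s * (1 - a\<^sup>2) * K = s\<^sup>2 * (\<kappa> * K) * (1 + a)\<^sup>2"
      unfolding e h_def by (simp add: power2_eq_square)
    also have "\<dots> \<le> 1 * (1 + a)\<^sup>2" using K by (intro mult_right_mono) simp_all
    finally show ?thesis by simp
  qed
  have "s * (1 - a\<^sup>2) * (\<kappa> * (v \<bullet> v)) \<le> s * (1 - a\<^sup>2) * (v \<bullet> A v)"
    using A(1) s2 by (rule mult_left_mono)
  then have 1: "(1 - a)\<^sup>2 * (v \<bullet> v) \<le> s * (1 - a\<^sup>2) * (v \<bullet> A v)" by (simp add: lo[symmetric] mult.assoc)
  have "s * (1 - a\<^sup>2) * (v \<bullet> A v) \<le> s * (1 - a\<^sup>2) * (K * (v \<bullet> v))"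
    using A(2) s2 by (rule mult_left_mono)
  also have "\<dots> \<le> (1 + a)\<^sup>2 * (v \<bullet> v)"
    using mult_right_mono[OF hi, of "v \<bullet> v"] by (simp add: mult.assoc)
  finally have 2: "s * (1 - a\<^sup>2) * (v \<bullet> A v) \<le> (1 + a)\<^sup>2 * (v \<bullet> v)" .
  have e: "v \<bullet> B v = (1 + a\<^sup>2) * (v \<bullet> v) - s * (1 - a\<^sup>2) * (v \<bullet> A v)"
    by (simp add: B inner_diff_right)
  show ?thesis using 1 2 unfolding e
    by (simp add: power2_eq_square abs_le_iff algebra_simps)
qed

theorem corollary4p11:
  fixes \<L> :: "real ^ 'n \<Rightarrow> real"
    and \<kappa> \<K> \<alpha> \<beta> \<gamma> \<epsilon> \<delta> :: real
    and \<Theta> m \<M> :: "real ^ 'n \<Rightarrow> nat \<Rightarrow> real ^ 'n"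
  assumes "0 < \<kappa>" and "0 < \<K>"
    and "C2 \<L>"
    and "grad \<L> 0 = 0"
    and "loewner_le (\<kappa> *\<^sub>R mat 1) (hess \<L> 0)"
    and "loewner_le (hess \<L> 0) (\<K> *\<^sub>R mat 1)"
    and "0 < \<alpha>" and "\<alpha> < 1" and "0 < \<beta>" and "\<beta> < 1"
    and "0 < \<gamma>" and "0 < \<epsilon>" and "0 < \<delta>"
    and "\<alpha> = ((1 - \<gamma> * inverse \<epsilon> * \<kappa>) / (1 + \<gamma> * inverse \<epsilon> * \<kappa>))\<^sup>2"
    and "\<gamma> \<le> \<epsilon> / sqrt (\<kappa> * \<K>)"
    and "\<And>\<theta>. \<Theta> \<theta> 0 = \<theta>"
    and "\<And>\<theta>. m \<theta> 0 = 0"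
    and "\<And>\<theta>. \<M> \<theta> 0 = 0"
    and "\<And>\<theta> n. n \<ge> 1 \<Longrightarrow>
           m \<theta> n = \<alpha> *\<^sub>R m \<theta> (n - 1) + (1 - \<alpha>) *\<^sub>R grad \<L> (\<Theta> \<theta> (n - 1))"
    and "\<And>\<theta> n. n \<ge> 1 \<Longrightarrow>
           \<M> \<theta> n = \<beta> *\<^sub>R \<M> \<theta> (n - 1) + (1 - \<beta>) *\<^sub>R (grad \<L> (\<Theta> \<theta> (n - 1)))\<^sup>2"
    and "\<And>\<theta> n. n \<ge> 1 \<Longrightarrow>
           \<Theta> \<theta> n = \<Theta> \<theta> (n - 1) - (\<gamma> * inverse (1 - \<alpha> ^ n)) *\<^sub>R
             ((\<epsilon> *\<^sub>R 1 + ((1 - \<beta> ^ n) powr (-1/2)) *\<^sub>R (\<M> \<theta> n vpowr (1/2))) vpowr (-1) * m \<theta> n)"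
  shows "\<exists>\<eta>>0. \<exists>c>0. \<forall>\<theta>. norm \<theta> < \<eta> \<longrightarrow>
           (\<forall>n\<ge>1. norm (\<Theta> \<theta> n) \<le> c * (sqrt \<alpha> + \<delta>) ^ n)"
proof -

  \<comment> \<open>Linearization at the origin and the step size conditions\<close>
  note \<kappa>0 = assms(1) and \<K>0 = assms(2) and smooth = assms(3)[unfolded C2_def] and grad0 = assms(4)
  note \<alpha>01 = assms(7,8) and \<beta>01 = assms(9,10) and \<gamma>0 = assms(11) and \<epsilon>0 = assms(12) and \<delta>0 = assms(13)
  note init = assms(16-18)
  have m_Suc: "m \<theta> (Suc n) = \<alpha> *\<^sub>R m \<theta> n + (1 - \<alpha>) *\<^sub>R grad \<L> (\<Theta> \<theta> n)" for \<theta> n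
    using assms(19)[of "Suc n"] by simp
  have \<M>_Suc: "\<M> \<theta> (Suc n) = \<beta> *\<^sub>R \<M> \<theta> n + (1 - \<beta>) *\<^sub>R (grad \<L> (\<Theta> \<theta> n))\<^sup>2" for \<theta> n
    using assms(20)[of "Suc n"] by simp
  define P :: "real ^ 'n \<Rightarrow> nat \<Rightarrow> real ^ 'n" where
    "P \<theta> n = (\<gamma> * inverse (1 - \<alpha> ^ n)) *\<^sub>R
      ((\<epsilon> *\<^sub>R 1 + ((1 - \<beta> ^ n) powr (-1/2)) *\<^sub>R (\<M> \<theta> n vpowr (1/2))) vpowr (-1))" for \<theta> n
  have \<Theta>_Suc: "\<Theta> \<theta> (Suc n) = \<Theta> \<theta> n - P \<theta> (Suc n) * m \<theta> (Suc n)" for \<theta> n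
    unfolding assms(21)[of "Suc n", simplified] by (simp add: P_def)
  define s where "s = \<gamma> / \<epsilon>"
  have s: "0 < s" using \<gamma>0 \<epsilon>0 by (simp add: s_def)
  define A where "A = (*v) (hess \<L> 0)"
  have A: "(grad \<L> has_derivative A) (at 0)"
    unfolding A_def using smooth by (intro has_derivative_grad_hess) simp
  have linA: "linear A" using A by (rule has_derivative_linear)
  have symA: "x \<bullet> A y = A x \<bullet> y" for x y
    by (rule derivative_of_gradient_symmetric[where f = \<L>, OF _ A]) (simp add: GDERIV_grad smooth)
  have A_lo: "\<kappa> * (x \<bullet> x) \<le> x \<bullet> A x" and A_hi: "x \<bullet> A x \<le> \<K> * (x \<bullet> x)" for x
    using assms(5,6) by (simp_all add: A_def loewner_le_def flip: scaleR_matrix_vector_assoc)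
  have \<kappa>\<K>: "\<kappa> \<le> \<K>"
  proof -
    have "0 < (1 :: real ^ 'n) \<bullet> 1" by (simp add: inner_vec_def)
    moreover have "\<kappa> * ((1 :: real ^ 'n) \<bullet> 1) \<le> \<K> * ((1 :: real ^ 'n) \<bullet> 1)" by (rule order_trans[OF A_lo A_hi])
    ultimately show ?thesis by simp
  qed
  have sK: "s\<^sup>2 * (\<kappa> * \<K>) \<le> 1"
  proof -
    have "s * sqrt (\<kappa> * \<K>) \<le> 1" using assms(15) \<epsilon>0 \<kappa>0 \<K>0 by (simp add: s_def field_simps)
    then have "(s * sqrt (\<kappa> * \<K>))\<^sup>2 \<le> 1" using s \<kappa>0 \<K>0 by (intro power_le_one) simp_all
    then show ?thesis using \<kappa>0 \<K>0 by (simp add: power_mult_distrib)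
  qed
  \<comment> \<open>Equality would force \<open>\<alpha> = 0\<close>. Strictness makes
    \<open>a\<close> positive, so that \<open>a\<close> and not \<open>- a\<close> is the root of
    \<alpha>.\<close>
  have s\<kappa>: "s * \<kappa> < 1"
  proof -
    have "(s * \<kappa>)\<^sup>2 \<le> s\<^sup>2 * (\<kappa> * \<K>)"
      unfolding power_mult_distrib power2_eq_square[of \<kappa>]
      using \<kappa>\<K> \<kappa>0 by (intro mult_left_mono) simp_all
    then have "s * \<kappa> \<le> 1" using sK by (metis order_trans one_power2 power2_le_imp_le zero_le_one)
    moreover have "s * \<kappa> \<noteq> 1" using assms(14) \<alpha>01 by (auto simp: s_def field_simps)
    ultimately show ?thesis by simp
  qed
  define a where "a = (1 - s * \<kappa>) / (1 + s * \<kappa>)"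
  have a: "0 < a" "a\<^sup>2 = \<alpha>" "sqrt \<alpha> = a"
  proof -
    show "0 < a" using s\<kappa> s \<kappa>0 by (simp add: a_def add_pos_pos)
    show "a\<^sup>2 = \<alpha>" using assms(14) by (simp add: a_def s_def divide_inverse)
    with \<open>0 < a\<close> show "sqrt \<alpha> = a" by (auto intro: real_sqrt_unique)
  qed
  have "a < 1" using a \<alpha>01 by (metis real_sqrt_lt_1_iff)
  \<comment> \<open>At most \<open>a + \<delta>\<close> for the claimed rate, and below 1 for the
    bootstrap even when \<delta> is large.\<close>
  define q where "q = min (a + \<delta>) ((1 + a) / 2)"
  have q: "a < q" "q \<le> a + \<delta>" "0 < q" "q < 1"
    using \<open>a < 1\<close> \<open>0 < a\<close> \<delta>0 by (auto simp: q_def min_less_iff_disj)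
  define B where "B v = (1 + \<alpha>) *\<^sub>R v - (s * (1 - \<alpha>)) *\<^sub>R A v" for v
  have linB: "linear B"
    by (intro linearI) (simp_all add: B_def linear_add[OF linA] linear_scale[OF linA] algebra_simps)
  have symB: "x \<bullet> B y = B x \<bullet> y" for x y
    by (simp add: B_def inner_simps symA)
  have bndB: "\<bar>x \<bullet> B x\<bar> \<le> 2 * a * (x \<bullet> x)" for x
    by (rule momentum_matrix_form_bound[where A = A and B = B, OF \<kappa>0 sK s A_lo A_hi a_def])
      (use s\<kappa> in \<open>simp_all add: B_def a(2)\<close>)
  obtain W C \<rho> where C: "0 < C" and \<rho>: "0 < \<rho>"
    and CW: "\<And>x y. (norm x)\<^sup>2 + (norm y)\<^sup>2 \<le> C * W x y"
    and WC: "\<And>x y. W x y \<le> C * ((norm x)\<^sup>2 + (norm y)\<^sup>2)"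
    and contract: "\<And>x y u v. \<lbrakk>norm u \<le> \<rho> * (norm x + norm y); norm v \<le> \<rho> * (norm x + norm y)\<rbrakk>
           \<Longrightarrow> W (B x - a\<^sup>2 *\<^sub>R y + u) (x + v) \<le> q\<^sup>2 * W x y"
    and grow: "\<And>R. \<exists>L. \<forall>x y u v. norm u \<le> R * (norm x + norm y) \<longrightarrow> norm v \<le> R * (norm x + norm y)
           \<longrightarrow> W (B x - a\<^sup>2 *\<^sub>R y + u) (x + v) \<le> L * W x y"
    by (rule momentum_lyapunov[where B = B, OF linB symB bndB a(1) q(1)]) (rule that)
  have W0: "0 \<le> W x y" for x y
    using CW[of x y] C by (smt (verit) mult_pos_neg zero_le_power2)

  \<comment> \<open>Error budget\<close>
  define e where "e = \<rho> / (2 * s)"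
  have e: "0 < e" "s * e = \<rho> / 2" using \<rho> s by (simp_all add: e_def)
  obtain d where d: "0 < d" and err: "\<And>x. norm x < d \<Longrightarrow> norm (grad \<L> x - A x) \<le> e * norm x"
    using A e(1) grad0 unfolding has_derivative_at_alt by auto
  obtain k where k: "\<And>x. norm (A x) \<le> k * norm x" "0 < k"
    using bounded_linear.pos_bounded[OF has_derivative_bounded_linear[OF A]] by (metis mult.commute)
  define K where "K = k + e"
  have K: "0 < K" using k e by (simp add: K_def)
  have gradK: "norm (grad \<L> x) \<le> K * norm x" if "norm x < d" for x
    using err[OF that] k(1)[of x] norm_triangle_sub[of "grad \<L> x" "A x"]
    by (simp add: K_def distrib_right)
  \<comment> \<open>\<open>s * e\<close> spends half of the tolerance \<rho> on linearizing the
    gradient; \<open>p\<close>, the admissible error of the preconditioner, spends the other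
    half.\<close>
  define p where "p = \<rho> / 2 / (1 / s + K)"
  have sK0: "0 < 1 / s + K" using s K by (simp add: add_pos_pos)
  have p: "0 < p" "p * (1 / s + K) = \<rho> / 2"
    using \<rho> sK0 p_def nonzero_eq_divide_eq[of "1 / s + K" p "\<rho> / 2"] by auto
  \<comment> \<open>Keeps the iterates where the gradient estimates hold, and the share of the
    second moment in the preconditioner error below \<open>p / 2\<close>. The other
    \<open>p / 2\<close> is for the bias correction, which complies from \<open>N\<close>
    on.\<close>
  define r where "r = min (d / 2) (p / 2 * \<epsilon>\<^sup>2 / (\<gamma> * K))"
  have r: "0 < r" "r < d" using d p \<epsilon>0 \<gamma>0 K by (auto simp: r_def)
  have rp: "\<gamma> * (K * r) / \<epsilon>\<^sup>2 \<le> p / 2"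
  proof -
    have "r \<le> p / 2 * \<epsilon>\<^sup>2 / (\<gamma> * K)" by (simp add: r_def)
    then show ?thesis using \<gamma>0 K \<epsilon>0 by (simp add: field_simps)
  qed
  \<comment> \<open>The shift makes \<open>t n\<close> the correction used in the step from
    \<open>n\<close> to \<open>Suc n\<close>, so that \<open>1 - \<alpha> ^ 0 = 0\<close> is never
    inverted.\<close>
  define t where "t n = inverse (1 - \<alpha> ^ Suc n)" for n
  have \<alpha>n: "0 \<le> \<alpha> ^ n" "\<alpha> ^ Suc n \<le> \<alpha>" for n
    using \<alpha>01 by (auto simp: mult_left_le power_le_one)
  have t1: "1 \<le> t n" and t2: "t n \<le> inverse (1 - \<alpha>)" for n
  proof -
    have "1 - \<alpha> \<le> 1 - \<alpha> ^ Suc n" "0 < 1 - \<alpha> ^ Suc n" "1 - \<alpha> ^ Suc n \<le> 1"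
      using \<alpha>n(1)[of "Suc n"] \<alpha>n(2)[of n] \<alpha>01 by linarith+
    then show "1 \<le> t n" "t n \<le> inverse (1 - \<alpha>)"
      unfolding t_def using \<alpha>01 by (auto intro: one_le_inverse le_imp_inverse_le simp del: power_Suc)
  qed
  obtain N where N: "\<And>n. N \<le> n \<Longrightarrow> s * (t n - 1) \<le> p / 2"
  proof -
    have "(\<lambda>n. s * (t n - 1)) \<longlonglongrightarrow> s * (inverse (1 - 0) - 1)"
      unfolding t_def using \<alpha>01
      by (intro tendsto_intros LIMSEQ_Suc[OF LIMSEQ_power_zero]) simp_all
    then have "\<forall>\<^sub>F n in sequentially. s * (t n - 1) < p / 2"
      by (rule order_tendstoD) (use p(1) in simp)
    then show thesis using that unfolding eventually_sequentially by (meson less_imp_le)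
  qed

  \<comment> \<open>One step of the algorithm near the origin\<close>
  define w where "w \<theta> n = W (\<Theta> \<theta> n) (\<Theta> \<theta> n + s *\<^sub>R m \<theta> n)" for \<theta> n
  \<comment> \<open>The second moment accumulates all earlier gradients, hence the hypothesis on the
    whole history.\<close>
  have Pbound: "\<bar>P \<theta> (Suc n) $ i - s\<bar> \<le> s * (t n - 1) + p / 2"
    if hist: "\<And>k. k \<le> n \<Longrightarrow> norm (\<Theta> \<theta> k) \<le> r" for \<theta> n i
  proof -
    have "\<bar>grad \<L> (\<Theta> \<theta> k) $ i\<bar> \<le> K * r" if "k < Suc n" for k
    proof -
      have "norm (\<Theta> \<theta> k) \<le> r" using hist that by simp
      then have "norm (grad \<L> (\<Theta> \<theta> k)) \<le> K * r"
        using gradK[of "\<Theta> \<theta> k"] r K by (smt (verit) mult_left_mono)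
      then show ?thesis using component_le_norm_cart order_trans by blast
    qed
    moreover have "(x :: real ^ 'n)\<^sup>2 $ i = (x $ i)\<^sup>2" for x
      by (simp add: power2_eq_square)
    ultimately have "0 \<le> \<M> \<theta> (Suc n) $ i \<and> \<M> \<theta> (Suc n) $ i \<le> (1 - \<beta> ^ Suc n) * (K * r)\<^sup>2"
      using \<beta>01 init
      by (intro second_moment_bounds[of \<beta> _ "\<lambda>k. grad \<L> (\<Theta> \<theta> k) $ i"]) (simp_all add: \<M>_Suc)
    moreover have "0 < 1 - \<beta> ^ Suc n" using \<beta>01 power_Suc_less_one[of \<beta> n] by simp
    ultimately have "\<bar>\<gamma> * t n * (\<epsilon> + (1 - \<beta> ^ Suc n) powr (-1/2) * (\<M> \<theta> (Suc n) $ i) powr (1/2)) powr (-1) - \<gamma> / \<epsilon>\<bar>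
      \<le> \<gamma> / \<epsilon> * (t n - 1) + \<gamma> * (K * r) / \<epsilon>\<^sup>2"
      using \<epsilon>0 \<gamma>0 K r t1 by (intro preconditioner_bounds) simp_all
    also have "\<gamma> * t n * (\<epsilon> + (1 - \<beta> ^ Suc n) powr (-1/2) * (\<M> \<theta> (Suc n) $ i) powr (1/2)) powr (-1)
      = P \<theta> (Suc n) $ i"
      by (simp add: P_def vpowr_def t_def)
    finally show ?thesis using rp unfolding s_def by linarith
  qed
  \<comment> \<open>\<open>p'\<close> is left free: it becomes \<open>p\<close> for the contraction
    from \<open>N\<close> on, and a crude time-independent bound for the growth estimate.\<close>
  have step: "\<exists>u v. w \<theta> (Suc n) = W (B x - a\<^sup>2 *\<^sub>R y + u) (x + v)
      \<and> norm u \<le> (p' * (1 / s + K) + s * e) * (norm x + norm y)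
      \<and> norm v \<le> (p' * (1 / s + K) + s * e) * (norm x + norm y)"
    if hist: "\<And>k. k \<le> n \<Longrightarrow> norm (\<Theta> \<theta> k) \<le> r" and p': "s * (t n - 1) + p / 2 \<le> p'"
      and xy: "x = \<Theta> \<theta> n" "y = \<Theta> \<theta> n + s *\<^sub>R m \<theta> n"
    for \<theta> n p' x y
  proof -
    have xd: "norm x < d" using hist[of n] r xy by simp
    obtain u v where
      "x - P \<theta> (Suc n) * m \<theta> (Suc n) = (1 + \<alpha>) *\<^sub>R x - (s * (1 - \<alpha>)) *\<^sub>R A x - \<alpha> *\<^sub>R y + u"
      "x - P \<theta> (Suc n) * m \<theta> (Suc n) + s *\<^sub>R m \<theta> (Suc n) = x + v"
      "norm u \<le> (p' * (1 / s + K) + s * e) * (norm x + norm y)"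
      "norm v \<le> (p' * (1 / s + K) + s * e) * (norm x + norm y)"
    proof (rule momentum_step_perturbation[of \<alpha> s "m \<theta> (Suc n)" "m \<theta> n" "grad \<L> x" K x "A x" e "P \<theta> (Suc n)" p' y])
      show "\<bar>P \<theta> (Suc n) $ i - s\<bar> \<le> p'" for i
        using Pbound[OF hist] p' by (rule order_trans)
    qed (use \<alpha>01 s m_Suc xy gradK[OF xd] err[OF xd] e(1) K in auto)
    then show ?thesis
      by (intro exI[of _ u] exI[of _ v]) (simp add: w_def \<Theta>_Suc B_def a(2) flip: xy(1))
  qed
  define p' where "p' = s * (inverse (1 - \<alpha>) - 1) + p / 2"
  obtain L0 where L0: "\<And>x y u v. norm u \<le> (p' * (1 / s + K) + s * e) * (norm x + norm y)
      \<Longrightarrow> norm v \<le> (p' * (1 / s + K) + s * e) * (norm x + norm y)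
      \<Longrightarrow> W (B x - a\<^sup>2 *\<^sub>R y + u) (x + v) \<le> L0 * W x y"
    using grow by blast
  define L where "L = max 1 L0"
  have w_grow: "w \<theta> (Suc n) \<le> L * w \<theta> n"
    if "\<And>k. k \<le> n \<Longrightarrow> norm (\<Theta> \<theta> k) \<le> r" for \<theta> n
  proof -
    have "s * (t n - 1) + p / 2 \<le> p'" using t2[of n] s by (simp add: p'_def)
    from step[OF that this refl refl] have "w \<theta> (Suc n) \<le> L0 * w \<theta> n"
      using L0 unfolding w_def[of _ n] by metis
    also have "\<dots> \<le> L * w \<theta> n" unfolding w_def using W0 by (intro mult_right_mono) (simp_all add: L_def)
    finally show ?thesis .
  qed
  have w_contract: "w \<theta> (Suc n) \<le> q\<^sup>2 * w \<theta> n"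
    if "N \<le> n" "\<And>k. k \<le> n \<Longrightarrow> norm (\<Theta> \<theta> k) \<le> r" for \<theta> n
  proof -
    have \<rho>_eq: "p * (1 / s + K) + s * e = \<rho>" using p e by simp
    have "s * (t n - 1) + p / 2 \<le> p" using N[OF that(1)] by simp
    from step[OF that(2) this refl refl] show ?thesis
      using contract unfolding w_def[of _ n] \<rho>_eq by metis
  qed

  \<comment> \<open>Initial radius and decay of the iterates\<close>
  define G where "G = C * (L / q\<^sup>2) ^ N * (2 * C)"
  have G: "0 < G" using C q by (simp add: G_def L_def)
  \<comment> \<open>\<open>G\<close> collects the passage from the norm to
    \<open>w \<theta> 0\<close> (factor \<open>2 * C\<close>, as zero momentum makes both positions
    equal to \<theta>), the initial growth, and the passage back. The radius is chosen for
    \<open>G * \<eta>\<^sup>2 = r\<^sup>2\<close>.\<close>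
  define \<eta> where "\<eta> = r / sqrt G"
  have \<eta>: "0 < \<eta>" using r G by (simp add: \<eta>_def)
  have "norm (\<Theta> \<theta> n) \<le> r * (sqrt \<alpha> + \<delta>) ^ n" if \<theta>: "norm \<theta> < \<eta>" for \<theta> n
  proof -
    have "w \<theta> 0 \<le> 2 * C * (norm \<theta>)\<^sup>2" using WC[of \<theta> \<theta>] by (simp add: w_def init)
    also have "\<dots> \<le> 2 * C * \<eta>\<^sup>2" using \<theta> C by (intro mult_left_mono power_mono) simp_all
    finally have "C * (L / q\<^sup>2) ^ N * w \<theta> 0 \<le> C * (L / q\<^sup>2) ^ N * (2 * C * \<eta>\<^sup>2)"
      using C q by (intro mult_left_mono) (simp_all add: L_def)
    also have "\<dots> = G * \<eta>\<^sup>2" by (simp add: G_def)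
    also have "\<dots> = r\<^sup>2" using G by (simp add: \<eta>_def power_divide)
    finally have start: "C * (L / q\<^sup>2) ^ N * w \<theta> 0 \<le> r\<^sup>2" .
    have small: "(norm (\<Theta> \<theta> n))\<^sup>2 \<le> C * w \<theta> n" for n
      using CW[of "\<Theta> \<theta> n" "\<Theta> \<theta> n + s *\<^sub>R m \<theta> n"] unfolding w_def by (smt (verit) zero_le_power2)
    have ball: "norm x \<le> r \<longleftrightarrow> (norm x)\<^sup>2 \<le> r\<^sup>2" for x :: "real ^ 'n"
      using r by (simp add: abs_le_square_iff[symmetric])
    \<comment> \<open>The bootstrap runs on squared norms with rate \<open>q\<^sup>2\<close>; after
      taking roots the constant is again \<open>r\<close>, the witness for \<open>c\<close>.\<close>
    have "w \<theta> n \<le> (L / q\<^sup>2) ^ N * (q\<^sup>2) ^ n * w \<theta> 0"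
    proof (rule eventually_contracting_bound[where z = "\<lambda>n. (norm (\<Theta> \<theta> n))\<^sup>2" and K = C and r = "r\<^sup>2"])
      show "(norm (\<Theta> \<theta> n))\<^sup>2 \<le> C * w \<theta> n" for n by (rule small)
    qed (use q C L_def start W0 w_grow w_contract in \<open>auto simp: w_def[of _ 0] ball power_le_one\<close>)
    then have "C * w \<theta> n \<le> C * ((L / q\<^sup>2) ^ N * (q\<^sup>2) ^ n * w \<theta> 0)"
      using C by (intro mult_left_mono) simp_all
    also have "\<dots> = C * (L / q\<^sup>2) ^ N * w \<theta> 0 * (q ^ n)\<^sup>2"
      by (simp add: mult_ac flip: power_mult)
    also have "\<dots> \<le> r\<^sup>2 * (q ^ n)\<^sup>2" by (rule mult_right_mono[OF start]) simp
    finally have "(norm (\<Theta> \<theta> n))\<^sup>2 \<le> (r * q ^ n)\<^sup>2"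
      using small[of n] by (simp add: power_mult_distrib)
    then have "norm (\<Theta> \<theta> n) \<le> r * q ^ n"
      using r q by (intro power2_le_imp_le[of "norm (\<Theta> \<theta> n)"]) simp_all
    also have "\<dots> \<le> r * (sqrt \<alpha> + \<delta>) ^ n"
      using r q a by (intro mult_left_mono power_mono) simp_all
    finally show ?thesis .
  qed
  then show ?thesis using \<eta> r by blast
qed

end
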